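(* Let $R$ be a weakly fadelian ring. Then $R$ is integral, i.e. for all $x,y\in R$, if $xy=0$ then $x=0$ or $y=0$.
   Context: All rings are nontrivial ($1\neq 0$), unital, associative, and not assumed commutative. A ring $R$ is weakly fadelian if for every nonzero $a\in R$ there exist $b,c\in R$ such that $1=ab+ca$. "Integral" means containing no zero divisors, without requiring commutativity. *)

theory Defs
  imports Main
begin

(* Class ring_1 provides unital, associative, not necessarily commutative rings with 0 \<noteq> 1.
   The ring is the whole type 'a, passed as TYPE('a); b and c may depend on a. *)
definition weakly_fadelian :: "'a::ring_1 itself \<Rightarrow> bool" where
  "weakly_fadelian _ \<longleftrightarrow> (\<forall>a::'a. a \<noteq> 0 \<longrightarrow> (\<exists>b c. 1 = a * b + c * a))"

end

theory Submission
  imports Defs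
begin

text \<open>
  Everything rests on a sandwich argument: if \<open>u\<close> kills a nonzero \<open>a\<close> from the left and
  \<open>v\<close> kills it from the right, then multiplying \<open>1 = a * b + c * a\<close> by \<open>u\<close> on the left and by
  \<open>v\<close> on the right gives \<open>u * v = 0\<close>. With \<open>u = v\<close> a two-sided annihilator of a nonzero
  element, this shows that such an annihilator squares to zero, so it suffices to know that
  the ring is reduced: then \<open>x * y = 0\<close> forces \<open>(y * x)\<^sup>2 = 0\<close>, hence \<open>y * x = 0\<close>, and \<open>y\<close> is a
  two-sided annihilator of \<open>x\<close>.

  Reducedness comes from idempotents. The sandwich argument applied to an idempotent
  \<open>e \<noteq> 0\<close> and its complement \<open>1 - e\<close> shows \<open>e = 1\<close>. If \<open>a * a = 0\<close> and \<open>1 = a * b + c * a\<close>,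
  then \<open>a = a * b * a\<close>, so \<open>a * b\<close> is idempotent; it is therefore \<open>0\<close> or \<open>1\<close>. In the
  first case \<open>a = a * b * a = 0\<close>, in the second \<open>a = a * (a * b) = 0\<close>.
\<close>

lemma weakly_fadelian_annihilators_mult_zero:
  fixes a u v :: "'a::ring_1"
  assumes "weakly_fadelian TYPE('a)" and "a \<noteq> 0" and "u * a = 0" and "a * v = 0"
  shows "u * v = 0"
proof -
  obtain b c where one: "1 = a * b + c * a"
    using assms(1,2) unfolding weakly_fadelian_def by blast
  have "u * v = u * (a * b + c * a) * v"
    using one by simp
  also have "\<dots> = (u * a) * b * v + u * c * (a * v)"
    by (simp add: algebra_simps)
  also have "\<dots> = 0"
    using assms(3,4) by simp
  finally show ?thesis .
qed

lemma weakly_fadelian_idempotent_trivial: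
  fixes e :: "'a::ring_1"
  assumes wf: "weakly_fadelian TYPE('a)" and idem: "e * e = e"
  shows "e = 0 \<or> e = 1"
proof (cases "e = 0")
  case False
  have "(1 - e) * e = 0" and "e * (1 - e) = 0"
    using idem by (simp_all add: algebra_simps)
  then have "(1 - e) * (1 - e) = 0"
    by (rule weakly_fadelian_annihilators_mult_zero[OF wf False])
  then have "1 - e = 0"
    using idem by (simp add: algebra_simps)
  then show ?thesis by simp
qed simp

lemma weakly_fadelian_reduced:
  fixes a :: "'a::ring_1"
  assumes wf: "weakly_fadelian TYPE('a)" and square: "a * a = 0"
  shows "a = 0"
proof (rule ccontr)
  assume "a \<noteq> 0"
  then obtain b c where one: "1 = a * b + c * a"
    using wf unfolding weakly_fadelian_def by blast
  have "a = (a * b + c * a) * a"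
    using one by simp
  then have regular: "a = a * b * a"
    using square by (simp add: distrib_right mult.assoc)
  then have "(a * b) * (a * b) = a * b"
    by (simp flip: mult.assoc)
  then consider "a * b = 0" | "a * b = 1"
    using weakly_fadelian_idempotent_trivial[OF wf] by blast
  then have "a = 0"
  proof cases
    case 1
    then show ?thesis using regular by simp
  next
    case 2
    have "a = a * (a * b)"
      using 2 by simp
    also have "\<dots> = 0"
      using square by (simp flip: mult.assoc)
    finally show ?thesis .
  qed
  then show False
    using \<open>a \<noteq> 0\<close> by contradiction
qed

theorem theorem2:
  assumes "weakly_fadelian TYPE('a::ring_1)"
  shows "\<forall>x y :: 'a. x * y = 0 \<longrightarrow> x = 0 \<or> y = 0"
proof (intro allI impI)
  fix x y :: 'a
  assume xy: "x * y = 0"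
  have "(y * x) * (y * x) = y * (x * y) * x"
    by (simp add: mult.assoc)
  then have "(y * x) * (y * x) = 0"
    using xy by simp
  then have yx: "y * x = 0"
    by (rule weakly_fadelian_reduced[OF assms])
  show "x = 0 \<or> y = 0"
  proof (cases "x = 0")
    case False
    have "y * y = 0"
      by (rule weakly_fadelian_annihilators_mult_zero[OF assms False yx xy])
    then show ?thesis
      using weakly_fadelian_reduced[OF assms] by blast
  qed simp
qed

end
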